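(* (Braid-Parafermion Relation) Let $N\ge2$ and let $$b_+=\frac{\omega^{-1/2}}{\sqrt N}\sum_{i=0}^{N-1}c_2^{-i}c_1^{\,i}\in PF_2$$ be the braid of the parafermion planar para algebra. Then the generator $c$ can move under the string: $$c_2\,b_+=b_+\,c_1 .$$
   Context: Let $q=e^{2\pi i/N}$, $\zeta$ a square root of $q$ with $\zeta^{N^2}=1$, $\omega=\frac1{\sqrt N}\sum_{i=0}^{N-1}\zeta^{i^2}$ (which satisfies $|\omega|=1$), $\omega^{1/2}$ a fixed square root of $\omega$ and $\omega^{-1/2}$ its inverse. $PF_2$ is the complex algebra generated by $c_1,c_2$ with $c_1^N=c_2^N=1$ and $c_1c_2=q\,c_2c_1$. It is the $2$-box space of the parafermion planar para algebra: $c_i$ is two vertical strings with the $i$-th labelled by the generator $c$, and $xy$ is drawn with $y$ stacked on top of $x$. $b_+$ is drawn as a crossing of two strings. *)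

theory Defs
  imports
    Complex_Main
    "HOL-Library.Poly_Mapping"
    "HOL-Algebra.QuotRing"
    "HOL-Algebra.Module"
    "HOL-Algebra.Algebraic_Closure_Type"
begin

text \<open>
  Words under concatenation, wrapped in a type of their own so that they can be made an instance
  of \<^class>\<open>monoid_add\<close>. With this instance, \<open>'g word \<Rightarrow>\<^sub>0 complex\<close> with the convolution product of
  \<^theory>\<open>HOL-Library.Poly_Mapping\<close> is the free unital associative complex algebra on \<open>'g\<close>.
\<close>

datatype 'g word = Word (letters: "'g list")

instantiation word :: (type) monoid_add
begin

definition zero_word :: "'a word" where
  "0 = Word []"

definition plus_word :: "'a word \<Rightarrow> 'a word \<Rightarrow> 'a word" where
  "u + v = Word (letters u @ letters v)"

instance
  by standard (simp_all add: zero_word_def plus_word_def)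

end

type_synonym 'g free_algebra = "'g word \<Rightarrow>\<^sub>0 complex"

definition free_gen :: "'g \<Rightarrow> 'g free_algebra" where
  "free_gen g = Poly_Mapping.single (Word [g]) 1"

definition free_scalar :: "complex \<Rightarrow> 'g free_algebra" where
  "free_scalar z = Poly_Mapping.single 0 z"

abbreviation free_ring :: "'g free_algebra ring" where
  "free_ring \<equiv> ring_of_type_algebra"

datatype pf_gen = C1 | C2

definition pf_q :: "nat \<Rightarrow> complex" where
  "pf_q N = exp (2 * of_real pi * \<i> / of_nat N)"

text \<open>A relation \<open>l = r\<close> is encoded by the element \<open>l - r\<close> of the free algebra.\<close>

definition pf_relations :: "nat \<Rightarrow> pf_gen free_algebra set" where
  "pf_relations N =
     {free_gen C1 ^ N - 1,
      free_gen C2 ^ N - 1,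
      free_gen C1 * free_gen C2 - free_scalar (pf_q N) * (free_gen C2 * free_gen C1)}"

definition pf_ideal :: "nat \<Rightarrow> pf_gen free_algebra set" where
  "pf_ideal N = Idl\<^bsub>free_ring\<^esub> (pf_relations N)"

text \<open>
  The algebra presented by \<open>c\<^sub>1, c\<^sub>2\<close> and the relations above. Its elements are cosets; the record
  type \<^typ>\<open>('a, 'b) module\<close> adds the scalar multiplication by complex numbers to the quotient ring,
  defined on cosets in the same way as \<^const>\<open>rcoset_mult\<close>.
\<close>

definition PF2 :: "nat \<Rightarrow> (complex, pf_gen free_algebra set) module" where
  "PF2 N = ring.extend (free_ring Quot (pf_ideal N))
     (module.fields (\<lambda>z A. \<Union>a\<in>A. pf_ideal N +>\<^bsub>free_ring\<^esub> (free_scalar z * a)))"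

definition pf_c1 :: "nat \<Rightarrow> pf_gen free_algebra set" where
  "pf_c1 N = pf_ideal N +>\<^bsub>free_ring\<^esub> free_gen C1"

definition pf_c2 :: "nat \<Rightarrow> pf_gen free_algebra set" where
  "pf_c2 N = pf_ideal N +>\<^bsub>free_ring\<^esub> free_gen C2"

definition pf_omega :: "nat \<Rightarrow> complex \<Rightarrow> complex" where
  "pf_omega N \<zeta> = 1 / of_real (sqrt (real N)) * (\<Sum>i = 0..N - 1. \<zeta> ^ (i\<^sup>2))"

text \<open>
  The argument \<open>w\<close> is the chosen square root of \<open>\<omega>\<close>. The exponent of \<open>c\<^sub>2\<close> is an integer, so its
  negative powers refer to the inverse in \<open>PF2 N\<close>.
\<close>

definition pf_braid :: "nat \<Rightarrow> complex \<Rightarrow> pf_gen free_algebra set" where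
  "pf_braid N w =
     (inverse w / of_real (sqrt (real N))) \<odot>\<^bsub>PF2 N\<^esub>
       (\<Oplus>\<^bsub>PF2 N\<^esub> i \<in> {0..N - 1}.
          pf_c2 N [^]\<^bsub>PF2 N\<^esub> (- int i) \<otimes>\<^bsub>PF2 N\<^esub> pf_c1 N [^]\<^bsub>PF2 N\<^esub> i)"

end

theory Submission
  imports Defs
begin

text \<open>
  Put \<open>f j = c\<^sub>2\<^bsup>1-j\<^esup> c\<^sub>1\<^bsup>j\<^esup>\<close>. Multiplying \<open>\<Sum>\<^sub>i c\<^sub>2\<^bsup>-i\<^esup> c\<^sub>1\<^bsup>i\<^esup>\<close> by \<open>c\<^sub>2\<close> on the left gives
  \<open>f 0 + \<dots> + f (N - 1)\<close>, multiplying it by \<open>c\<^sub>1\<close> on the right gives \<open>f 1 + \<dots> + f N\<close>. The two sums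
  agree because \<open>f\<close> has period \<open>N\<close>: \<open>c\<^sub>1\<^bsup>N\<^esup> = c\<^sub>2\<^bsup>N\<^esup> = 1\<close> yields \<open>f N = c\<^sub>2 = f 0\<close>. This argument works
  in any ring for two elements whose \<open>N\<close>-th power is \<open>1\<close> (lemma \<open>cyclic_sum_intertwines\<close>), and a
  central factor in front of the sum does not disturb it.

  What remains is to see that the argument applies to \<open>PF2 N\<close>: it is a quotient of the
  free algebra by a two-sided ideal, the coset map is a ring homomorphism that turns the relations
  into equations, and the scalar multiplication is multiplication by the coset of a scalar, which is
  central (lemmas \<open>PF2_smult\<close> and \<open>pf_coset_scalar_central\<close>).
\<close>

text \<open>
  An inverse power of an element of finite order is a natural power, so that integer exponents
  can be traded for natural ones.
\<close>

lemma (in monoid) int_pow_neg_of_finite_order: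
  assumes x: "x \<in> carrier G" and ord: "x [^] N = \<one>" and le: "i \<le> N"
  shows "x [^] (- int i) = x [^] (N - i)"
proof -
  have "inv (x [^] i) = x [^] (N - i)"
    using assms by (intro inv_char) (simp_all add: nat_pow_mult)
  moreover have "x [^] (- int i) = inv (x [^] i)"
    by (cases "i = 0") (simp_all add: int_pow_def2)
  ultimately show ?thesis by simp
qed

lemma (in ring) cyclic_sum_intertwines:
  assumes a: "a \<in> carrier R" and b: "b \<in> carrier R"
    and N: "N > 0" and aN: "a [^] N = \<one>" and bN: "b [^] N = \<one>"
  shows "b \<otimes> (\<Oplus>i\<in>{0..N - 1}. b [^] (- int i) \<otimes> a [^] i)
       = (\<Oplus>i\<in>{0..N - 1}. b [^] (- int i) \<otimes> a [^] i) \<otimes> a"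
proof -
  obtain n where n: "N = Suc n" using N by (cases N) auto
  \<comment> \<open>\<open>f j\<close> is \<open>b\<^bsup>1-j\<^esup> a\<^bsup>j\<^esup>\<close>; the exponent of \<open>b\<close> is shifted by \<open>N\<close> to make it natural for all \<open>j \<le> N\<close>.\<close>
  define f where "f j = b [^] (N + 1 - j) \<otimes> a [^] j" for j :: nat
  have f_closed: "f j \<in> carrier R" for j
    using a b by (simp add: f_def)
  have neg: "b [^] (- int i) = b [^] (N - i)" if "i \<le> n" for i
    using int_pow_neg_of_finite_order[OF b bN] that n by simp
  have sum_eq: "(\<Oplus>i\<in>{0..N - 1}. b [^] (- int i) \<otimes> a [^] i) = (\<Oplus>i\<in>{..n}. b [^] (N - i) \<otimes> a [^] i)"
    using a b by (intro finsum_cong') (auto simp: n neg)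
  have left: "b \<otimes> (b [^] (N - i) \<otimes> a [^] i) = f i" if "i \<le> n" for i
  proof -
    have "b \<otimes> b [^] (N - i) = b [^] (N + 1 - i)"
      using b that n nat_pow_mult[of b 1 "N - i"] by (simp add: Suc_diff_le)
    then show ?thesis
      using a b by (simp add: f_def m_assoc[symmetric])
  qed
  have right: "(b [^] (N - i) \<otimes> a [^] i) \<otimes> a = f (Suc i)" if "i \<le> n" for i
    using a b by (simp add: f_def m_assoc)
  have "b \<otimes> (\<Oplus>i\<in>{..n}. b [^] (N - i) \<otimes> a [^] i) = (\<Oplus>i\<in>{..n}. b \<otimes> (b [^] (N - i) \<otimes> a [^] i))"
    using a b by (intro finsum_rdistr) auto
  also have "\<dots> = (\<Oplus>i\<in>{..n}. f i)"
    using f_closed by (intro finsum_cong') (auto simp: left)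
  also have "\<dots> = (\<Oplus>i\<in>{..n}. f (Suc i))"
  proof -
    have "f 0 \<oplus> (\<Oplus>i\<in>{..n}. f (Suc i)) = (\<Oplus>i\<in>{..Suc n}. f i)"
      using finsum_Suc2[of f n] f_closed by (simp add: a_comm)
    also have "\<dots> = f (Suc n) \<oplus> (\<Oplus>i\<in>{..n}. f i)"
      using f_closed by simp
    \<comment> \<open>periodicity: \<open>f N\<close> is \<open>b \<otimes> a\<^bsup>N\<^esup>\<close> and \<open>f 0\<close> is \<open>b\<^bsup>N+1\<^esup>\<close>, and both are \<open>b\<close>\<close>
    also have "f (Suc n) = f 0"
      using a b aN bN n by (simp add: f_def)
    finally show ?thesis
      using f_closed by (simp add: add.l_cancel)
  qed
  also have "\<dots> = (\<Oplus>i\<in>{..n}. (b [^] (N - i) \<otimes> a [^] i) \<otimes> a)"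
    using a b f_closed by (intro finsum_cong') (auto simp: right)
  also have "\<dots> = (\<Oplus>i\<in>{..n}. b [^] (N - i) \<otimes> a [^] i) \<otimes> a"
    using a b by (intro finsum_ldistr[symmetric]) auto
  finally show ?thesis
    by (simp only: sum_eq)
qed

lemma ring_ring_of_type_algebra: "ring (ring_of_type_algebra :: 'a::ring_1 ring)"
proof -
  have "\<exists>y. x + y = 0" for x :: 'a
    using add.right_inverse by blast
  then show ?thesis
    unfolding ring_of_type_algebra_def using add.right_inverse
    by unfold_locales (auto simp: algebra_simps Units_def)
qed

lemma ring_of_type_algebra_simps:
  "carrier (ring_of_type_algebra :: 'a::ring_1 ring) = UNIV"
  "x \<otimes>\<^bsub>ring_of_type_algebra\<^esub> y = (x * y :: 'a)"
  "\<one>\<^bsub>ring_of_type_algebra\<^esub> = (1 :: 'a)"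
  "x \<oplus>\<^bsub>ring_of_type_algebra\<^esub> y = (x + y :: 'a)"
  "\<zero>\<^bsub>ring_of_type_algebra\<^esub> = (0 :: 'a)"
  by (simp_all add: ring_of_type_algebra_def)

lemma nat_pow_ring_of_type_algebra:
  "x [^]\<^bsub>ring_of_type_algebra\<^esub> (n::nat) = (x ^ n :: 'a::ring_1)"
  by (induction n) (simp_all add: ring_of_type_algebra_simps nat_pow_def power_commutes)

lemma a_minus_ring_of_type_algebra:
  "x \<ominus>\<^bsub>ring_of_type_algebra\<^esub> y = (x - y :: 'a::ring_1)"
proof -
  interpret ring "ring_of_type_algebra :: 'a ring" by (rule ring_ring_of_type_algebra)
  have "\<ominus>\<^bsub>ring_of_type_algebra\<^esub> y = - y"
    by (rule minus_equality) (simp_all add: ring_of_type_algebra_simps)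
  then show ?thesis
    by (simp add: a_minus_def ring_of_type_algebra_simps)
qed

text \<open>A scalar is supported on the empty word, which is neutral for concatenation on both sides.\<close>

lemma free_scalar_central: "free_scalar z * p = p * free_scalar z"
proof (induction p rule: update_induct)
  case const
  show ?case by simp
next
  case (update f k v)
  have "Poly_Mapping.update k v f = f + Poly_Mapping.single k v"
    using update.hyps
    by (intro poly_mapping_eqI)
      (auto simp: Poly_Mapping.lookup_update lookup_add lookup_single when_def in_keys_iff)
  moreover have "free_scalar z * Poly_Mapping.single k v = Poly_Mapping.single k v * free_scalar z"
    by (simp add: free_scalar_def mult_single mult.commute)
  ultimately show ?case
    using update.IH by (simp add: distrib_left distrib_right)
qed

lemma ring_extend_simps:
  "carrier (ring.extend R m) = carrier R"
  "monoid.mult (ring.extend R m) = monoid.mult R"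
  "one (ring.extend R m) = one R"
  "zero (ring.extend R m) = zero R"
  "add (ring.extend R m) = add R"
  by (simp_all add: ring.defs)

text \<open>The ring axioms only speak of the fields that the extension of the record retains.\<close>

lemma ring_extend:
  assumes "ring R"
  shows "ring (ring.extend R m)"
proof -
  interpret ring R by fact
  show ?thesis
    by (intro ringI abelian_groupI monoidI)
      (auto simp: ring_extend_simps a_assoc m_assoc l_distr r_distr a_ac
        intro: exI[of _ "\<ominus>\<^bsub>R\<^esub> _"] l_neg)
qed

lemma ideal_pf_ideal: "ideal (pf_ideal N) free_ring"
  unfolding pf_ideal_def
  by (rule ring.genideal_ideal[OF ring_ring_of_type_algebra]) (simp add: ring_of_type_algebra_simps)

abbreviation pf_coset :: "nat \<Rightarrow> pf_gen free_algebra \<Rightarrow> pf_gen free_algebra set" where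
  "pf_coset N \<equiv> (+>\<^bsub>free_ring\<^esub>) (pf_ideal N)"

lemma ring_PF2: "ring (PF2 N)"
  unfolding PF2_def by (intro ring_extend ideal.quotient_is_ring ideal_pf_ideal)

lemma pf_coset_hom: "pf_coset N \<in> ring_hom free_ring (PF2 N)"
  using ideal.rcos_ring_hom[OF ideal_pf_ideal]
  by (simp add: ring_hom_def PF2_def ring_extend_simps)

lemma pf_coset_surj:
  assumes "A \<in> carrier (PF2 N)"
  obtains x where "A = pf_coset N x"
  using assms by (auto simp: PF2_def ring_extend_simps FactRing_def A_RCOSETS_def')

text \<open>
  The union that defines the scalar multiplication ranges over representatives of the given coset
  only, the one that defines the product also over those of the coset of \<open>z\<close>; since the ideal absorbs the
  difference, both are the coset of the product of two representatives.
\<close>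

lemma PF2_smult:
  assumes "A \<in> carrier (PF2 N)"
  shows "z \<odot>\<^bsub>PF2 N\<^esub> A = pf_coset N (free_scalar z) \<otimes>\<^bsub>PF2 N\<^esub> A"
proof -
  interpret ideal "pf_ideal N" free_ring by (rule ideal_pf_ideal)
  interpret h: ring_hom_ring free_ring "PF2 N" "pf_coset N"
    by (intro ring_hom_ringI2 ring_ring_of_type_algebra ring_PF2 pf_coset_hom)
  obtain x where x: "A = pf_coset N x" using assms by (rule pf_coset_surj)
  have "pf_coset N (free_scalar z * a) = pf_coset N (free_scalar z * x)" if "a \<in> A" for a
  proof -
    have "pf_coset N a = pf_coset N x"
      using that unfolding x
      by (metis UNIV_I a_repr_independence' ring_of_type_algebra_simps(1))
    then show ?thesis
      using h.hom_mult[of "free_scalar z"] by (simp add: ring_of_type_algebra_simps)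
  qed
  moreover have "x \<in> A"
    unfolding x by (rule a_rcos_self) (simp add: ring_of_type_algebra_simps)
  ultimately have "(\<Union>a\<in>A. pf_coset N (free_scalar z * a)) = pf_coset N (free_scalar z * x)"
    by blast
  then show ?thesis
    using h.hom_mult[of "free_scalar z" x]
    by (simp add: x PF2_def ring.defs module.defs ring_of_type_algebra_simps)
qed

lemma pf_coset_scalar_central:
  assumes "A \<in> carrier (PF2 N)"
  shows "pf_coset N (free_scalar z) \<otimes>\<^bsub>PF2 N\<^esub> A = A \<otimes>\<^bsub>PF2 N\<^esub> pf_coset N (free_scalar z)"
proof -
  obtain x where "A = pf_coset N x" using assms by (rule pf_coset_surj)
  then show ?thesis
    using ring_hom_mult[OF pf_coset_hom, of "free_scalar z" x N]
      ring_hom_mult[OF pf_coset_hom, of x "free_scalar z" N]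
    by (simp add: ring_of_type_algebra_simps free_scalar_central)
qed

lemma pf_coset_power_one:
  assumes "x ^ N - 1 \<in> pf_relations N"
  shows "pf_coset N x [^]\<^bsub>PF2 N\<^esub> N = \<one>\<^bsub>PF2 N\<^esub>"
proof -
  interpret h: ring_hom_ring free_ring "PF2 N" "pf_coset N"
    by (intro ring_hom_ringI2 ring_ring_of_type_algebra ring_PF2 pf_coset_hom)
  have "x ^ N - 1 \<in> pf_ideal N"
    using assms h.R.genideal_self[of "pf_relations N"]
    by (auto simp: pf_ideal_def ring_of_type_algebra_simps)
  then have "pf_coset N (x ^ N) = pf_coset N 1"
    using h.R.quotient_eq_iff_same_a_r_cos[OF ideal_pf_ideal, of "x ^ N" 1 N]
    by (simp add: a_minus_ring_of_type_algebra ring_of_type_algebra_simps)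
  then show ?thesis
    using h.hom_nat_pow[of x N] h.hom_one
    by (simp add: nat_pow_ring_of_type_algebra ring_of_type_algebra_simps)
qed

lemma pf_c1_power: "pf_c1 N [^]\<^bsub>PF2 N\<^esub> N = \<one>\<^bsub>PF2 N\<^esub>"
  unfolding pf_c1_def by (rule pf_coset_power_one) (simp add: pf_relations_def)

lemma pf_c2_power: "pf_c2 N [^]\<^bsub>PF2 N\<^esub> N = \<one>\<^bsub>PF2 N\<^esub>"
  unfolding pf_c2_def by (rule pf_coset_power_one) (simp add: pf_relations_def)

theorem theorem8p2:
  fixes N :: nat and \<zeta> w :: complex
  assumes "N \<ge> 2"
    and "\<zeta>\<^sup>2 = pf_q N"
    and "\<zeta> ^ (N\<^sup>2) = 1"
    and "w\<^sup>2 = pf_omega N \<zeta>"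
  shows "pf_c2 N \<otimes>\<^bsub>PF2 N\<^esub> pf_braid N w = pf_braid N w \<otimes>\<^bsub>PF2 N\<^esub> pf_c1 N"
proof -
  interpret P: ring "PF2 N" by (rule ring_PF2)
  have coset: "pf_coset N x \<in> carrier (PF2 N)" for x
    using ring_hom_closed[OF pf_coset_hom] by (simp add: ring_of_type_algebra_simps)
  have c1: "pf_c1 N \<in> carrier (PF2 N)" and c2: "pf_c2 N \<in> carrier (PF2 N)"
    by (simp_all add: pf_c1_def pf_c2_def coset)
  define s where "s = pf_coset N (free_scalar (inverse w / of_real (sqrt (real N))))"
  define S where "S = (\<Oplus>\<^bsub>PF2 N\<^esub> i \<in> {0..N - 1}.
    pf_c2 N [^]\<^bsub>PF2 N\<^esub> (- int i) \<otimes>\<^bsub>PF2 N\<^esub> pf_c1 N [^]\<^bsub>PF2 N\<^esub> i)"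
  have s: "s \<in> carrier (PF2 N)"
    by (simp add: s_def coset)
  have S: "S \<in> carrier (PF2 N)"
    unfolding S_def using assms(1) c1 c2
    by (auto intro!: P.finsum_closed
        simp: P.int_pow_neg_of_finite_order[OF c2 pf_c2_power])
  have braid: "pf_braid N w = s \<otimes>\<^bsub>PF2 N\<^esub> S"
    unfolding pf_braid_def s_def S_def[symmetric] by (rule PF2_smult[OF S])
  have "pf_c2 N \<otimes>\<^bsub>PF2 N\<^esub> pf_braid N w = s \<otimes>\<^bsub>PF2 N\<^esub> (pf_c2 N \<otimes>\<^bsub>PF2 N\<^esub> S)"
    using c2 s S pf_coset_scalar_central[OF c2]
    by (simp add: braid s_def P.m_assoc[symmetric])
  also have "pf_c2 N \<otimes>\<^bsub>PF2 N\<^esub> S = S \<otimes>\<^bsub>PF2 N\<^esub> pf_c1 N"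
    unfolding S_def using assms(1)
    by (intro P.cyclic_sum_intertwines c1 c2 pf_c1_power pf_c2_power) simp
  finally show ?thesis
    using c1 s S by (simp add: braid P.m_assoc)
qed

end
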